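(* Let $(X,\omega_X,J)$ be a compact Fano Kähler manifold of complex dimension $n$ with $\omega_X$ in the class normalized so that $\mathrm{Ric}(\omega_X)-\omega_X=\sqrt{-1}\partial\bar\partial\phi$ for a real function $\phi$, normalized by $\frac1V\int_X(e^\phi-1)\frac{\omega_X^n}{n!}=0$, where $V=\int_X\frac{\omega_X^n}{n!}$. Let $\xi,\eta\in\mathfrak{aut}(X,\omega_X,J)$. Then the Tian–Zhu generalized Futaki invariant satisfies $$\frac{\int_X\widetilde\theta_\eta\, e^{\widetilde\theta_\xi}\,\omega_X^n}{\int_X e^{\widetilde\theta_\xi}\,\omega_X^n}=\big\langle d\widehat{\mathbf{D}_F}(\hat\theta_\xi)-\mu(J),\ \theta_\eta\big\rangle ,$$ where $$\mu(J)=\frac1V(e^\phi-1)\frac{\omega_X^n}{n!},\qquad d\widehat{\mathbf{D}_F}(u)=\frac1V(e^u-1)\frac{\omega_X^n}{n!}.$$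
   Context: $\mathfrak{aut}(X,\omega_X,J)$ denotes the Lie algebra of (real) vector fields on $X$ preserving $\omega_X$ and $J$; these are Hamiltonian. For $\eta\in\mathfrak{aut}(X,\omega_X,J)$ the functions $\theta_\eta,\hat\theta_\eta,\widetilde\theta_\eta$ are the three Hamiltonians of $\eta$, i.e. real functions with $$d\theta_\eta=d\hat\theta_\eta=d\widetilde\theta_\eta=\omega_X(\eta,\cdot),$$ with the respective normalizations $$\int_X\theta_\eta\frac{\omega_X^n}{n!}=0,\qquad \int_X(e^{\hat\theta_\eta}-1)\frac{\omega_X^n}{n!}=0,\qquad \int_X\widetilde\theta_\eta\, e^{\phi}\,\frac{\omega_X^n}{n!}=0 .$$ The pairing between a top-degree form $\Theta$ and a function $\theta$ is $\langle\Theta,\theta\rangle=\int_X\theta\,\Theta$. (Here $\mu$ is the moment map for the action of Hamiltonian diffeomorphisms on integrable $\omega_X$-compatible complex structures with Berndtsson's Kähler metric, and $\widehat{\mathbf{D}_F}$ is the Legendre transform of $\mathbf{D}_F$; only the displayed formulas for $\mu(J)$ and $d\widehat{\mathbf{D}_F}$ are needed.) *)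

theory Defs
  imports "HOL-Analysis.Analysis" "HOL-Combinatorics.Permutations"
begin

section \<open>Calculus on open subsets of complex coordinate space\<close>

primrec k_smooth_on :: "nat \<Rightarrow> 'a::real_normed_vector set \<Rightarrow> ('a \<Rightarrow> 'b::real_normed_vector) \<Rightarrow> bool" where
  "k_smooth_on 0 S f \<longleftrightarrow> continuous_on S f"
| "k_smooth_on (Suc k) S f \<longleftrightarrow>
     (\<forall>x\<in>S. f differentiable (at x)) \<and>
     (\<forall>v. k_smooth_on k S (\<lambda>x. frechet_derivative f (at x) v))"

text \<open>Only used for open \<^term>\<open>S\<close>.\<close>
definition smooth_on :: "'a::real_normed_vector set \<Rightarrow> ('a \<Rightarrow> 'b::real_normed_vector) \<Rightarrow> bool" where
  "smooth_on S f \<longleftrightarrow> (\<forall>k. k_smooth_on k S f)"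

text \<open>The complex structure of the coordinate space; in holomorphic coordinates it is the
  complex structure \<open>J\<close> of the manifold.\<close>
definition J :: "complex^'n \<Rightarrow> complex^'n" where
  "J v = \<i> *s v"

definition holomorphic_map_on :: "(complex^'n) set \<Rightarrow> (complex^'n \<Rightarrow> complex^'m) \<Rightarrow> bool" where
  "holomorphic_map_on S f \<longleftrightarrow>
     (\<forall>z\<in>S. f differentiable (at z) \<and>
        (\<forall>v. frechet_derivative f (at z) (J v) = J (frechet_derivative f (at z) v)))"

text \<open>The Wirtinger derivatives \<open>\<partial>/\<partial>z\<^sub>j = (\<partial>/\<partial>x\<^sub>j - \<i> \<partial>/\<partial>y\<^sub>j)/2\<close> and
  \<open>\<partial>/\<partial>\<bar>z\<^sub>j = (\<partial>/\<partial>x\<^sub>j + \<i> \<partial>/\<partial>y\<^sub>j)/2\<close>.\<close>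
definition d_z :: "'n \<Rightarrow> (complex^'n \<Rightarrow> complex) \<Rightarrow> complex^'n \<Rightarrow> complex" where
  "d_z j f z = (frechet_derivative f (at z) (axis j 1) - \<i> * frechet_derivative f (at z) (axis j \<i>)) / 2"

definition d_zbar :: "'n \<Rightarrow> (complex^'n \<Rightarrow> complex) \<Rightarrow> complex^'n \<Rightarrow> complex" where
  "d_zbar j f z = (frechet_derivative f (at z) (axis j 1) + \<i> * frechet_derivative f (at z) (axis j \<i>)) / 2"

text \<open>The two-form \<open>\<i> \<Sum>\<^sub>j\<^sub>k (\<partial>\<^sup>2f/\<partial>z\<^sub>j\<partial>\<bar>z\<^sub>k) dz\<^sub>j \<and> d\<bar>z\<^sub>k\<close>, evaluated at \<open>u, v\<close>.  For real
  \<open>f\<close> of class \<open>C\<^sup>2\<close> the sum is real, so taking the real part only adjusts the type.\<close>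
definition i_ddbar :: "(complex^'n \<Rightarrow> real) \<Rightarrow> complex^'n \<Rightarrow> complex^'n \<Rightarrow> complex^'n \<Rightarrow> real" where
  "i_ddbar f z u v =
     Re (\<i> * (\<Sum>j\<in>UNIV. \<Sum>k\<in>UNIV. d_z j (d_zbar k (\<lambda>w. complex_of_real (f w))) z
                 * (u $ j * cnj (v $ k) - v $ j * cnj (u $ k))))"

section \<open>Complex manifolds\<close>

text \<open>The manifold is the whole type \<open>'a\<close>; a chart is a domain with a coordinate map.\<close>
type_synonym ('a, 'n) chart = "'a set \<times> ('a \<Rightarrow> complex^'n)"

definition chart_dom :: "('a, 'n::finite) chart \<Rightarrow> 'a set" where
  "chart_dom c = fst c"

definition coord :: "('a, 'n::finite) chart \<Rightarrow> 'a \<Rightarrow> complex^'n" where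
  "coord c = snd c"

definition chart_img :: "('a, 'n::finite) chart \<Rightarrow> (complex^'n) set" where
  "chart_img c = coord c ` chart_dom c"

definition chart_inv :: "('a, 'n::finite) chart \<Rightarrow> complex^'n \<Rightarrow> 'a" where
  "chart_inv c = inv_into (chart_dom c) (coord c)"

definition overlap :: "('a, 'n::finite) chart \<Rightarrow> ('a, 'n::finite) chart \<Rightarrow> (complex^'n) set" where
  "overlap c d = coord c ` (chart_dom c \<inter> chart_dom d)"

definition transition :: "('a, 'n::finite) chart \<Rightarrow> ('a, 'n::finite) chart \<Rightarrow> complex^'n \<Rightarrow> complex^'n" where
  "transition c d z = coord d (chart_inv c z)"

definition holomorphic_atlas :: "('a::topological_space, 'n::finite) chart set \<Rightarrow> bool" where
  "holomorphic_atlas A \<longleftrightarrow>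
     (\<Union>c\<in>A. chart_dom c) = UNIV \<and>
     (\<forall>c\<in>A. open (chart_dom c) \<and> open (chart_img c) \<and>
        homeomorphism (chart_dom c) (chart_img c) (coord c) (chart_inv c)) \<and>
     (\<forall>c\<in>A. \<forall>d\<in>A. holomorphic_map_on (overlap c d) (transition c d))"

text \<open>Second countability is automatic for compact manifolds; manifolds are taken to be connected.\<close>
definition compact_complex_manifold :: "('a::t2_space, 'n::finite) chart set \<Rightarrow> bool" where
  "compact_complex_manifold A \<longleftrightarrow>
     holomorphic_atlas A \<and> compact (UNIV :: 'a set) \<and> connected (UNIV :: 'a set)"

section \<open>Functions, vector fields and forms\<close>

text \<open>Tensor fields are given by their coordinate representatives, one for every chart, as functions
  of the coordinate; on overlaps these obey the usual transformation laws.\<close>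

definition in_chart :: "('a \<Rightarrow> real) \<Rightarrow> ('a, 'n::finite) chart \<Rightarrow> complex^'n \<Rightarrow> real" where
  "in_chart f c z = f (chart_inv c z)"

definition smooth_function :: "('a, 'n::finite) chart set \<Rightarrow> ('a \<Rightarrow> real) \<Rightarrow> bool" where
  "smooth_function A f \<longleftrightarrow> (\<forall>c\<in>A. smooth_on (chart_img c) (in_chart f c))"

type_synonym ('a, 'n) vfield = "('a, 'n) chart \<Rightarrow> complex^'n \<Rightarrow> complex^'n"
type_synonym ('a, 'n) form1 = "('a, 'n) chart \<Rightarrow> complex^'n \<Rightarrow> complex^'n \<Rightarrow> real"
type_synonym ('a, 'n) form2 = "('a, 'n) chart \<Rightarrow> complex^'n \<Rightarrow> complex^'n \<Rightarrow> complex^'n \<Rightarrow> real"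

text \<open>A top-degree form is represented by its coefficient with respect to
  \<open>dx\<^sub>1 \<and> dy\<^sub>1 \<and> \<dots> \<and> dx\<^sub>n \<and> dy\<^sub>n\<close>, where \<open>z\<^sub>j = x\<^sub>j + \<i> y\<^sub>j\<close>.\<close>
type_synonym ('a, 'n) top_form = "('a, 'n) chart \<Rightarrow> complex^'n \<Rightarrow> real"

definition vector_field :: "('a, 'n::finite) chart set \<Rightarrow> ('a, 'n::finite) vfield \<Rightarrow> bool" where
  "vector_field A \<eta> \<longleftrightarrow>
     (\<forall>c\<in>A. smooth_on (chart_img c) (\<eta> c)) \<and>
     (\<forall>c\<in>A. \<forall>d\<in>A. \<forall>z\<in>overlap c d.
        \<eta> d (transition c d z) = frechet_derivative (transition c d) (at z) (\<eta> c z))"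

definition one_form :: "('a, 'n::finite) chart set \<Rightarrow> ('a, 'n::finite) form1 \<Rightarrow> bool" where
  "one_form A \<alpha> \<longleftrightarrow>
     (\<forall>c\<in>A. (\<forall>z\<in>chart_img c. linear (\<alpha> c z)) \<and>
        (\<forall>v. smooth_on (chart_img c) (\<lambda>z. \<alpha> c z v))) \<and>
     (\<forall>c\<in>A. \<forall>d\<in>A. \<forall>z\<in>overlap c d. \<forall>v.
        \<alpha> c z v = \<alpha> d (transition c d z) (frechet_derivative (transition c d) (at z) v))"

definition two_form :: "('a, 'n::finite) chart set \<Rightarrow> ('a, 'n::finite) form2 \<Rightarrow> bool" where
  "two_form A \<omega> \<longleftrightarrow>
     (\<forall>c\<in>A. (\<forall>z\<in>chart_img c. bilinear (\<omega> c z) \<and> (\<forall>u v. \<omega> c z u v = - \<omega> c z v u)) \<and>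
        (\<forall>u v. smooth_on (chart_img c) (\<lambda>z. \<omega> c z u v))) \<and>
     (\<forall>c\<in>A. \<forall>d\<in>A. \<forall>z\<in>overlap c d. \<forall>u v.
        \<omega> c z u v = \<omega> d (transition c d z) (frechet_derivative (transition c d) (at z) u)
                                           (frechet_derivative (transition c d) (at z) v))"

text \<open>Exterior derivatives, evaluated on constant coordinate vector fields.\<close>

definition d_one :: "('a, 'n::finite) form1 \<Rightarrow> ('a, 'n::finite) form2" where
  "d_one \<alpha> c z u v = frechet_derivative (\<lambda>w. \<alpha> c w v) (at z) u
                   - frechet_derivative (\<lambda>w. \<alpha> c w u) (at z) v"

definition closed_two_form :: "('a, 'n::finite) chart set \<Rightarrow> ('a, 'n::finite) form2 \<Rightarrow> bool" where
  "closed_two_form A \<omega> \<longleftrightarrow>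
     (\<forall>c\<in>A. \<forall>z\<in>chart_img c. \<forall>u v w.
        frechet_derivative (\<lambda>y. \<omega> c y v w) (at z) u
      - frechet_derivative (\<lambda>y. \<omega> c y u w) (at z) v
      + frechet_derivative (\<lambda>y. \<omega> c y u v) (at z) w = 0)"

definition cohomologous :: "('a, 'n::finite) chart set \<Rightarrow> ('a, 'n::finite) form2 \<Rightarrow> ('a, 'n::finite) form2 \<Rightarrow> bool" where
  "cohomologous A \<omega> \<omega>' \<longleftrightarrow>
     (\<exists>\<alpha>. one_form A \<alpha> \<and>
        (\<forall>c\<in>A. \<forall>z\<in>chart_img c. \<forall>u v. \<omega> c z u v - \<omega>' c z u v = d_one \<alpha> c z u v))"

section \<open>Integration of top-degree forms\<close>

text \<open>\<^term>\<open>\<rho> c\<close> is supported in the chart \<^term>\<open>c\<close>.  Continuity of the partition is all that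
  integration needs.\<close>
definition partition_of_unity ::
    "('a::topological_space, 'n::finite) chart set \<Rightarrow> ('a, 'n::finite) chart set \<times> (('a, 'n::finite) chart \<Rightarrow> 'a \<Rightarrow> real) \<Rightarrow> bool" where
  "partition_of_unity A = (\<lambda>(F, \<rho>).
     finite F \<and> F \<subseteq> A \<and>
     (\<forall>c\<in>F. continuous_on UNIV (\<rho> c) \<and> (\<forall>x. 0 \<le> \<rho> c x) \<and> closure {x. \<rho> c x \<noteq> 0} \<subseteq> chart_dom c) \<and>
     (\<forall>x. (\<Sum>c\<in>F. \<rho> c x) = 1))"

text \<open>The coordinate space carries Lebesgue measure \<open>dx\<^sub>1 dy\<^sub>1 \<dots> dx\<^sub>n dy\<^sub>n\<close> and the manifold its complex
  orientation.  The choice of the partition is immaterial for forms obeying the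
  transformation law.\<close>
definition top_integral :: "('a::topological_space, 'n::finite) chart set \<Rightarrow> ('a, 'n::finite) top_form \<Rightarrow> real" where
  "top_integral A \<Theta> =
     (case (SOME P. partition_of_unity A P) of (F, \<rho>) \<Rightarrow>
        \<Sum>c\<in>F. LINT z : chart_img c | lborel. \<rho> c (chart_inv c z) * \<Theta> c z)"

definition times_form :: "('a \<Rightarrow> real) \<Rightarrow> ('a, 'n::finite) top_form \<Rightarrow> ('a, 'n::finite) top_form" (infixr "\<cdot>\<^sub>F" 70) where
  "(f \<cdot>\<^sub>F \<Theta>) c z = f (chart_inv c z) * \<Theta> c z"

definition diff_form :: "('a, 'n::finite) top_form \<Rightarrow> ('a, 'n::finite) top_form \<Rightarrow> ('a, 'n::finite) top_form" (infixl "-\<^sub>F" 65) where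
  "(\<Theta> -\<^sub>F \<Theta>') c z = \<Theta> c z - \<Theta>' c z"

definition pairing :: "('a::topological_space, 'n::finite) chart set \<Rightarrow> ('a, 'n::finite) top_form \<Rightarrow> ('a \<Rightarrow> real) \<Rightarrow> real" where
  "pairing A \<Theta> \<theta> = top_integral A (\<theta> \<cdot>\<^sub>F \<Theta>)"

section \<open>Kaehler geometry\<close>

definition kaehler_form :: "('a, 'n::finite) chart set \<Rightarrow> ('a, 'n::finite) form2 \<Rightarrow> bool" where
  "kaehler_form A \<omega> \<longleftrightarrow>
     two_form A \<omega> \<and> closed_two_form A \<omega> \<and>
     (\<forall>c\<in>A. \<forall>z\<in>chart_img c.
        (\<forall>u v. \<omega> c z (J u) (J v) = \<omega> c z u v) \<and> (\<forall>u. u \<noteq> 0 \<longrightarrow> \<omega> c z u (J u) > 0))"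

text \<open>The real frame \<open>\<partial>/\<partial>x\<^sub>j, \<partial>/\<partial>y\<^sub>j\<close>.\<close>
definition real_frame :: "'n \<times> bool \<Rightarrow> complex^'n" where
  "real_frame = (\<lambda>(j, b). axis j (if b then \<i> else 1))"

text \<open>The coefficient of the \<open>n\<close>-fold wedge power of \<open>\<omega>\<close>, from
  \<open>\<omega>\<^sup>n(e\<^sub>1, \<dots>, e\<^sub>2\<^sub>n) = 2\<^sup>-\<^sup>n \<Sum>\<^sub>\<sigma> sgn \<sigma> \<Prod>\<^sub>j \<omega>(e\<^bsub>\<sigma>(2j-1)\<^esub>, e\<^bsub>\<sigma>(2j)\<^esub>)\<close>
  evaluated on the oriented frame \<open>\<partial>/\<partial>x\<^sub>1, \<partial>/\<partial>y\<^sub>1, \<dots>, \<partial>/\<partial>x\<^sub>n, \<partial>/\<partial>y\<^sub>n\<close>.  Frame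
  vectors are indexed by \<open>'n \<times> bool\<close>: reordering \<open>'n\<close> permutes pairs of frame
  vectors, so the result does not depend on an enumeration of \<open>'n\<close>.\<close>
definition wedge_power :: "('a, 'n::finite) form2 \<Rightarrow> ('a, 'n::finite) top_form" where
  "wedge_power \<omega> c z =
     (\<Sum>\<sigma> | \<sigma> permutes (UNIV :: ('n \<times> bool) set). of_int (sign \<sigma>) *
        (\<Prod>j\<in>UNIV. \<omega> c z (real_frame (\<sigma> (j, False))) (real_frame (\<sigma> (j, True))))) / 2 ^ CARD('n)"

text \<open>\<open>\<omega>\<^sup>n/n!\<close>\<close>
definition volume_form :: "('a, 'n::finite) form2 \<Rightarrow> ('a, 'n::finite) top_form" where
  "volume_form \<omega> c z = wedge_power \<omega> c z / fact CARD('n)"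

definition volume :: "('a::topological_space, 'n::finite) chart set \<Rightarrow> ('a, 'n::finite) form2 \<Rightarrow> real" where
  "volume A \<omega> = top_integral A (volume_form \<omega>)"

text \<open>The Ricci form \<open>- \<i> \<partial>\<partial>\<bar> log det(g)\<close>, where the coefficient of
  \<open>\<omega>\<^sup>n/n!\<close> equals \<open>det(g)\<close> up to a constant factor.\<close>
definition ricci_form :: "('a, 'n::finite) form2 \<Rightarrow> ('a, 'n::finite) form2" where
  "ricci_form \<omega> c z u v = - i_ddbar (\<lambda>w. ln (volume_form \<omega> c w)) z u v"

text \<open>The class \<open>2\<pi>c\<^sub>1\<close> of the manifold, which is represented by the Ricci form of any Kaehler metric,
  contains a Kaehler form.\<close>
definition fano :: "('a, 'n::finite) chart set \<Rightarrow> bool" where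
  "fano A \<longleftrightarrow>
     (\<exists>\<omega> \<omega>'. kaehler_form A \<omega> \<and> kaehler_form A \<omega>' \<and> cohomologous A (ricci_form \<omega>) \<omega>')"

definition ricci_potential :: "('a, 'n::finite) chart set \<Rightarrow> ('a, 'n::finite) form2 \<Rightarrow> ('a \<Rightarrow> real) \<Rightarrow> bool" where
  "ricci_potential A \<omega> \<phi> \<longleftrightarrow>
     smooth_function A \<phi> \<and>
     (\<forall>c\<in>A. \<forall>z\<in>chart_img c. \<forall>u v.
        ricci_form \<omega> c z u v - \<omega> c z u v = i_ddbar (in_chart \<phi> c) z u v)"

text \<open>Lie derivatives along \<open>\<eta>\<close>, evaluated on constant coordinate vector fields \<open>u, v\<close>, for which
  \<open>[\<eta>, v] = - D\<eta>(v)\<close>; thus \<open>(L\<^sub>\<eta> J)(v) = [\<eta>, J v] - J [\<eta>, v]\<close>.\<close>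

definition lie_two_form :: "('a, 'n::finite) vfield \<Rightarrow> ('a, 'n::finite) form2 \<Rightarrow> ('a, 'n::finite) form2" where
  "lie_two_form \<eta> \<omega> c z u v =
     frechet_derivative (\<lambda>w. \<omega> c w u v) (at z) (\<eta> c z)
     + \<omega> c z (frechet_derivative (\<eta> c) (at z) u) v
     + \<omega> c z u (frechet_derivative (\<eta> c) (at z) v)"

definition lie_J :: "('a, 'n::finite) vfield \<Rightarrow> ('a, 'n::finite) chart \<Rightarrow> complex^'n \<Rightarrow> complex^'n \<Rightarrow> complex^'n" where
  "lie_J \<eta> c z v = J (frechet_derivative (\<eta> c) (at z) v) - frechet_derivative (\<eta> c) (at z) (J v)"

definition aut :: "('a, 'n::finite) chart set \<Rightarrow> ('a, 'n::finite) form2 \<Rightarrow> ('a, 'n::finite) vfield set" where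
  "aut A \<omega> = {\<eta>. vector_field A \<eta> \<and>
     (\<forall>c\<in>A. \<forall>z\<in>chart_img c.
        (\<forall>u v. lie_two_form \<eta> \<omega> c z u v = 0) \<and> (\<forall>v. lie_J \<eta> c z v = 0))}"

text \<open>\<open>d\<theta> = \<omega>(\<eta>, \<cdot>)\<close>\<close>
definition hamiltonian :: "('a, 'n::finite) chart set \<Rightarrow> ('a, 'n::finite) form2 \<Rightarrow> ('a, 'n::finite) vfield \<Rightarrow> ('a \<Rightarrow> real) \<Rightarrow> bool" where
  "hamiltonian A \<omega> \<eta> \<theta> \<longleftrightarrow>
     smooth_function A \<theta> \<and>
     (\<forall>c\<in>A. \<forall>z\<in>chart_img c. \<forall>v.
        frechet_derivative (in_chart \<theta> c) (at z) v = \<omega> c z (\<eta> c z) v)"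

definition moment_map ::
    "('a::topological_space, 'n::finite) chart set \<Rightarrow> ('a, 'n::finite) form2 \<Rightarrow> ('a \<Rightarrow> real) \<Rightarrow> ('a, 'n::finite) top_form" where
  "moment_map A \<omega> \<phi> = (\<lambda>x. 1 / volume A \<omega> * (exp (\<phi> x) - 1)) \<cdot>\<^sub>F volume_form \<omega>"

text \<open>The differential at \<open>u\<close> of the Legendre transform of the Ding functional \<open>\<^bold>D\<^sub>F\<close>.\<close>
definition d_ding_hat ::
    "('a::topological_space, 'n::finite) chart set \<Rightarrow> ('a, 'n::finite) form2 \<Rightarrow> ('a \<Rightarrow> real) \<Rightarrow> ('a, 'n::finite) top_form" where
  "d_ding_hat A \<omega> u = (\<lambda>x. 1 / volume A \<omega> * (exp (u x) - 1)) \<cdot>\<^sub>F volume_form \<omega>"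

text \<open>The generalized Futaki invariant of Tian and Zhu, in terms of Hamiltonians \<open>\<theta>\<close> normalized by
  \<open>\<integral> \<theta> e\<^sup>\<phi> \<omega>\<^sup>n = 0\<close>.\<close>
definition tian_zhu_invariant ::
    "('a::topological_space, 'n::finite) chart set \<Rightarrow> ('a, 'n::finite) form2 \<Rightarrow> ('a \<Rightarrow> real) \<Rightarrow> ('a \<Rightarrow> real) \<Rightarrow> real" where
  "tian_zhu_invariant A \<omega> \<theta>\<^sub>\<eta> \<theta>\<^sub>\<xi> =
     top_integral A ((\<lambda>x. \<theta>\<^sub>\<eta> x * exp (\<theta>\<^sub>\<xi> x)) \<cdot>\<^sub>F wedge_power \<omega>)
     / top_integral A ((\<lambda>x. exp (\<theta>\<^sub>\<xi> x)) \<cdot>\<^sub>F wedge_power \<omega>)"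

end

theory Submission
  imports Defs
begin

text \<open>Two Hamiltonians of one field differ by a constant, as the manifold is connected.  So
  \<open>\<theta>_tilde\<^sub>\<xi> = \<theta>_hat\<^sub>\<xi> + b\<close>, and \<open>b\<close> cancels in the Tian--Zhu quotient, whose denominator becomes
  \<open>V\<close>; and \<open>\<theta>_tilde\<^sub>\<eta> = \<theta>\<^sub>\<eta> + a\<close>, where the normalizations give
  \<open>a = - 1/V \<integral> \<theta>\<^sub>\<eta> e\<^sup>\<phi> \<omega>\<^sup>n/n!\<close>.\<close>

section \<open>Partitions of unity\<close>

lemma holomorphic_atlas_chartD:
  assumes "holomorphic_atlas A" "c \<in> A"
  shows "open (chart_dom c)" "open (chart_img c)"
    "homeomorphism (chart_dom c) (chart_img c) (coord c) (chart_inv c)"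
  using assms unfolding holomorphic_atlas_def by auto

text \<open>The image of the ball under \<open>chart_inv c\<close> is compact, hence closed in the
  whole Hausdorff manifold and not merely in the chart. Supports of bump functions require this
  stronger closedness.\<close>

lemma chart_closed_ball_preimage:
  fixes A :: "('a::t2_space, 'n::finite) chart set"
  assumes A: "holomorphic_atlas A" and c: "c \<in> A" and p: "cball p r \<subseteq> chart_img c"
  shows "closed (chart_inv c ` cball p r)" "chart_inv c ` cball p r \<subseteq> chart_dom c"
    and "y \<in> chart_dom c \<Longrightarrow> y \<in> chart_inv c ` cball p r \<longleftrightarrow> dist p (coord c y) \<le> r"
proof -
  note h = holomorphic_atlas_chartD(3)[OF A c]
  have "continuous_on (cball p r) (chart_inv c)"
    using h p by (meson continuous_on_subset homeomorphism_cont2)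
  then show "closed (chart_inv c ` cball p r)"
    by (intro compact_imp_closed compact_continuous_image) auto
  show "chart_inv c ` cball p r \<subseteq> chart_dom c"
    using h p by (metis homeomorphism_image2 image_mono)
  show "y \<in> chart_inv c ` cball p r \<longleftrightarrow> dist p (coord c y) \<le> r" if "y \<in> chart_dom c"
  proof
    assume "y \<in> chart_inv c ` cball p r"
    then obtain z where "z \<in> cball p r" "y = chart_inv c z" by auto
    then show "dist p (coord c y) \<le> r"
      using h p by (metis homeomorphism_apply2 mem_cball subsetD)
  next
    assume "dist p (coord c y) \<le> r"
    then show "y \<in> chart_inv c ` cball p r"
      using h that by (metis homeomorphism_apply1 imageI mem_cball)
  qed
qed

text \<open>A cone over a small coordinate ball is extended by zero. The set \<open>K\<close> is
  passed on because it traps the closure of the support inside the chart.\<close>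

lemma bump_function_exists:
  fixes A :: "('a::t2_space, 'n::finite) chart set"
  assumes A: "holomorphic_atlas A" and c: "c \<in> A" and x: "x \<in> chart_dom c"
  obtains g :: "'a \<Rightarrow> real" and K where "continuous_on UNIV g" "\<And>y. 0 \<le> g y" "0 < g x"
    "closed K" "K \<subseteq> chart_dom c" "{y. g y \<noteq> 0} \<subseteq> K"
proof -
  note h = holomorphic_atlas_chartD[OF A c]
  let ?p = "coord c x"
  have "?p \<in> chart_img c" using x by (simp add: chart_img_def)
  then obtain r where r: "r > 0" and rc: "cball ?p r \<subseteq> chart_img c"
    using h(2) open_contains_cball by blast
  let ?K = "chart_inv c ` cball ?p r"
  note K = chart_closed_ball_preimage[OF A c rc]
  define g where "g y = (if y \<in> chart_dom c then max 0 (r - dist ?p (coord c y)) else 0)" for y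
  have supp: "g y = 0" if "y \<notin> ?K" for y
    using K(3)[of y] that by (auto simp: g_def)
  have "continuous_on (chart_dom c) g"
  proof (rule continuous_on_eq)
    show "continuous_on (chart_dom c) (\<lambda>y. max 0 (r - dist ?p (coord c y)))"
      using homeomorphism_cont1[OF h(3)] by (intro continuous_intros)
  qed (simp add: g_def)
  moreover have "continuous_on (- ?K) g"
    by (rule continuous_on_eq[where f = "\<lambda>_. 0"]) (use supp in auto)
  \<comment> \<open>The two pieces are open and cover the manifold, so no separate argument at the
    boundary of the chart is required.\<close>
  ultimately have "continuous_on (chart_dom c \<union> - ?K) g"
    using h(1) K(1) by (intro continuous_on_open_Un) auto
  moreover have "chart_dom c \<union> - ?K = UNIV" using K(2) by auto
  ultimately have "continuous_on UNIV g" by simp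
  moreover have "0 < g x" using r x by (simp add: g_def)
  moreover have "0 \<le> g y" for y by (simp add: g_def)
  ultimately show thesis
    using that[of g ?K] K(1,2) supp by blast
qed

text \<open>By compactness finitely many bumps have a positive sum, and dividing by it normalizes
  them. Existence gives meaning to the \<open>SOME\<close> in \<open>top_integral\<close>.\<close>

lemma partition_of_unity_exists:
  fixes A :: "('a::t2_space, 'n::finite) chart set"
  assumes A: "holomorphic_atlas A" and compact: "compact (UNIV :: 'a set)"
  shows "\<exists>P. partition_of_unity A P"
proof -
  have "\<exists>c g K. c \<in> A \<and> continuous_on UNIV g \<and> (\<forall>y. 0 \<le> g y) \<and> 0 < g x \<and>
      closed K \<and> K \<subseteq> chart_dom c \<and> {y. g y \<noteq> (0::real)} \<subseteq> K" for x
  proof -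
    have "x \<in> (\<Union>c\<in>A. chart_dom c)" using A unfolding holomorphic_atlas_def by simp
    then obtain c where c: "c \<in> A" "x \<in> chart_dom c" by blast
    then show ?thesis using bump_function_exists[OF A c] by metis
  qed
  then obtain ch g K where chA: "\<And>x. ch x \<in> A"
    and g: "\<And>x. continuous_on UNIV (g x)" "\<And>x y. 0 \<le> g x y" "\<And>x. 0 < g x x"
    and K: "\<And>x. closed (K x)" "\<And>x. K x \<subseteq> chart_dom (ch x)" "\<And>x. {y. g x y \<noteq> (0::real)} \<subseteq> K x"
    by metis
  have op: "open {y. 0 < g x y}" for x
    using g(1)[of x] by (intro open_Collect_less continuous_on_const)
  have cover: "UNIV \<subseteq> (\<Union>x\<in>UNIV. {y. 0 < g x y})"
    using g(3) by blast
  obtain S where S: "finite S" "UNIV \<subseteq> (\<Union>x\<in>S. {y. 0 < g x y})"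
    by (rule compactE_image[OF compact op cover])
  define G where "G y = (\<Sum>x\<in>S. g x y)" for y
  have G: "G y > 0" for y
  proof -
    obtain x where "x \<in> S" "0 < g x y" using S(2) by blast
    then show ?thesis unfolding G_def using S(1) g(2) by (intro sum_pos2[of S x]) auto
  qed
  have Gc: "continuous_on UNIV G" unfolding G_def using g(1) by (intro continuous_intros)
  \<comment> \<open>A partition is indexed by charts, whereas several points of \<open>S\<close> may
    share one chart; their bumps are therefore added up.\<close>
  define \<rho> where "\<rho> c y = (\<Sum>x\<in>{x\<in>S. ch x = c}. g x y) / G y" for c y
  have "partition_of_unity A (ch ` S, \<rho>)"
    unfolding partition_of_unity_def prod.case
  proof (intro conjI ballI allI)
    show "finite (ch ` S)" "ch ` S \<subseteq> A" using S chA by auto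
    fix c
    show "continuous_on UNIV (\<rho> c)"
      unfolding \<rho>_def using g(1) Gc G by (intro continuous_intros) (auto simp: less_le)
    show "0 \<le> \<rho> c y" for y
      unfolding \<rho>_def using g(2) G[of y] by (intro divide_nonneg_pos sum_nonneg) auto
    \<comment> \<open>A finite union of closed sets inside \<open>chart_dom c\<close>, so it
      contains the closure of the support of \<open>\<rho> c\<close>.\<close>
    let ?U = "\<Union>(K ` {y\<in>S. ch y = c})"
    have "closed ?U" using S(1) K(1) by auto
    moreover have "{y. \<rho> c y \<noteq> 0} \<subseteq> ?U"
    proof (rule subsetI, rule ccontr)
      fix y assume y: "y \<in> {y. \<rho> c y \<noteq> 0}" "y \<notin> ?U"
      then have "g z y = 0" if "z \<in> S" "ch z = c" for z
        using that K(3)[of z] by blast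
      then have "\<rho> c y = 0" unfolding \<rho>_def by (simp add: sum.neutral)
      with y show False by simp
    qed
    ultimately have "closure {y. \<rho> c y \<noteq> 0} \<subseteq> ?U" by (intro closure_minimal)
    also have "?U \<subseteq> chart_dom c" using K(2) by fast
    finally show "closure {y. \<rho> c y \<noteq> 0} \<subseteq> chart_dom c" .
  next
    fix y
    have "(\<Sum>c\<in>ch ` S. \<rho> c y) = (\<Sum>c\<in>ch ` S. \<Sum>x\<in>{x\<in>S. ch x = c}. g x y) / G y"
      unfolding \<rho>_def by (simp only: sum_divide_distrib)
    also have "\<dots> = G y / G y" unfolding G_def by (simp only: sum.image_gen[OF S(1), symmetric])
    finally show "(\<Sum>c\<in>ch ` S. \<rho> c y) = 1" using G[of y] by simp
  qed
  then show ?thesis by blast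
qed

section \<open>Linearity of the integral\<close>

definition continuous_form :: "('a, 'n::finite) chart set \<Rightarrow> ('a, 'n) top_form \<Rightarrow> bool" where
  "continuous_form A \<Theta> \<longleftrightarrow> (\<forall>c\<in>A. continuous_on (chart_img c) (\<Theta> c))"

text \<open>The coefficient of the form may be unbounded towards the edge of the chart image, but
  the partition function confines the integrand to a compact set on which it is continuous.\<close>

lemma partition_set_integrable:
  fixes A :: "('a::t2_space, 'n::finite) chart set"
  assumes A: "holomorphic_atlas A" and compact: "compact (UNIV :: 'a set)"
    and P: "partition_of_unity A (F, \<rho>)" and c: "c \<in> F" and \<Theta>: "continuous_form A \<Theta>"
  shows "set_integrable lborel (chart_img c) (\<lambda>z. \<rho> c (chart_inv c z) * \<Theta> c z)"
proof -
  have cA: "c \<in> A" and \<rho>c: "continuous_on UNIV (\<rho> c)"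
    and supp: "closure {x. \<rho> c x \<noteq> 0} \<subseteq> chart_dom c"
    using P c by (auto simp: partition_of_unity_def)
  note h = holomorphic_atlas_chartD(3)[OF A cA]
  define f where "f z = \<rho> c (chart_inv c z) * \<Theta> c z" for z
  define K where "K = coord c ` closure {x. \<rho> c x \<noteq> 0}"
  have "compact (closure {x. \<rho> c x \<noteq> 0})"
    using compact_Int_closed[OF compact, of "closure {x. \<rho> c x \<noteq> 0}"] by simp
  then have cK: "compact K"
    unfolding K_def using supp homeomorphism_cont1[OF h]
    by (metis compact_continuous_image continuous_on_subset)
  have KI: "K \<subseteq> chart_img c" unfolding K_def chart_img_def using supp by blast
  have "continuous_on (chart_img c) (\<lambda>z. \<rho> c (chart_inv c z))"
    using continuous_on_compose2[OF \<rho>c homeomorphism_cont2[OF h]] by simp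
  then have "continuous_on (chart_img c) f"
    unfolding f_def using \<Theta> cA by (auto simp: continuous_form_def intro!: continuous_intros)
  then have "continuous_on K f" using KI continuous_on_subset by blast
  then have "set_integrable lborel K f"
    unfolding set_integrable_def by (rule borel_integrable_compact[OF cK])
  \<comment> \<open>The integrand vanishes on the chart image outside \<open>K\<close>, so
    integrability over \<open>K\<close> carries over.\<close>
  moreover have "indicat_real (chart_img c) z *\<^sub>R f z = indicat_real K z *\<^sub>R f z" for z
  proof (cases "z \<in> K")
    case True
    then show ?thesis using KI by auto
  next
    case False
    have "f z = 0" if "z \<in> chart_img c"
    proof -
      have "chart_inv c z \<notin> {x. \<rho> c x \<noteq> 0}"
        using False that homeomorphism_apply2[OF h] closure_subset unfolding K_def
        by (metis (no_types, lifting) image_eqI subsetD)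
      then show ?thesis by (simp add: f_def)
    qed
    then show ?thesis using False by (auto simp: indicator_def)
  qed
  ultimately show ?thesis unfolding set_integrable_def f_def by (simp only:)
qed

text \<open>The chosen partition depends on \<open>A\<close> alone, so all three integrals use the
  same one; linearity then holds chart by chart, where integrability allows splitting.\<close>

lemma top_integral_linear:
  fixes A :: "('a::t2_space, 'n::finite) chart set"
  assumes A: "compact_complex_manifold A"
    and \<Theta>: "continuous_form A \<Theta>" and \<Theta>': "continuous_form A \<Theta>'"
  shows "top_integral A (\<lambda>c z. a * \<Theta> c z + b * \<Theta>' c z) = a * top_integral A \<Theta> + b * top_integral A \<Theta>'"
proof -
  have at: "holomorphic_atlas A" and co: "compact (UNIV :: 'a set)"
    using A by (auto simp: compact_complex_manifold_def)
  obtain F \<rho> where FP: "(SOME P. partition_of_unity A P) = (F, \<rho>)" by fastforce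
  then have P: "partition_of_unity A (F, \<rho>)"
    using someI_ex[OF partition_of_unity_exists[OF at co]] by simp
  note int = partition_set_integrable[OF at co P]
  have "(LINT z : chart_img c | lborel. \<rho> c (chart_inv c z) * (a * \<Theta> c z + b * \<Theta>' c z)) =
      a * (LINT z : chart_img c | lborel. \<rho> c (chart_inv c z) * \<Theta> c z) +
      b * (LINT z : chart_img c | lborel. \<rho> c (chart_inv c z) * \<Theta>' c z)" if "c \<in> F" for c
  proof -
    have "(\<lambda>z. \<rho> c (chart_inv c z) * (a * \<Theta> c z + b * \<Theta>' c z)) =
        (\<lambda>z. a * (\<rho> c (chart_inv c z) * \<Theta> c z) + b * (\<rho> c (chart_inv c z) * \<Theta>' c z))"
      by (simp add: algebra_simps)
    then show ?thesis
      using set_integral_add(2)[OF set_integrable_mult_right[of a, OF int[OF that \<Theta>]]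
          set_integrable_mult_right[of b, OF int[OF that \<Theta>']]]
      by (simp only: set_integral_mult_right)
  qed
  then show ?thesis
    unfolding top_integral_def FP by (simp add: sum.distrib sum_distrib_left)
qed

section \<open>Continuity of functions and forms read in charts\<close>

definition continuous_in_charts :: "('a, 'n::finite) chart set \<Rightarrow> ('a \<Rightarrow> real) \<Rightarrow> bool" where
  "continuous_in_charts A f \<longleftrightarrow> (\<forall>c\<in>A. continuous_on (chart_img c) (\<lambda>z. f (chart_inv c z)))"

lemma smooth_function_continuous:
  assumes "smooth_function A f" shows "continuous_in_charts A f"
proof -
  have "k_smooth_on 0 (chart_img c) (in_chart f c)" if "c \<in> A" for c
    using assms that unfolding smooth_function_def smooth_on_def by blast
  then show ?thesis unfolding continuous_in_charts_def in_chart_def[abs_def] by simp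
qed

lemma continuous_in_charts_intros:
  assumes "continuous_in_charts A f"
  shows "continuous_in_charts A (\<lambda>x. exp (f x))"
    and "continuous_in_charts A g \<Longrightarrow> continuous_in_charts A (\<lambda>x. f x * g x)"
  using assms unfolding continuous_in_charts_def by (auto intro!: continuous_intros)

lemma continuous_in_charts_const: "continuous_in_charts A (\<lambda>x. k)"
  unfolding continuous_in_charts_def by auto

lemma continuous_form_times:
  "continuous_in_charts A f \<Longrightarrow> continuous_form A \<Theta> \<Longrightarrow> continuous_form A (f \<cdot>\<^sub>F \<Theta>)"
  unfolding continuous_in_charts_def continuous_form_def times_form_def[abs_def]
  by (auto intro!: continuous_intros)

text \<open>The coefficient is a polynomial in the continuous components of \<open>\<omega>\<close>
  on the real frame.\<close>

lemma two_form_volume_form_continuous: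
  assumes "two_form A \<omega>" shows "continuous_form A (volume_form \<omega>)"
proof -
  have "continuous_on (chart_img c) (\<lambda>z. \<omega> c z u v)" if "c \<in> A" for c u v
  proof -
    have "k_smooth_on 0 (chart_img c) (\<lambda>z. \<omega> c z u v)"
      using assms that unfolding two_form_def smooth_on_def by blast
    then show ?thesis by simp
  qed
  then show ?thesis
    unfolding continuous_form_def volume_form_def[abs_def] wedge_power_def[abs_def]
    by (auto intro!: continuous_intros)
qed

section \<open>Hamiltonians of a field\<close>

text \<open>Both differentials equal \<omega>(\<eta>, .), so the difference has zero derivative on
  each coordinate ball. It is thus locally constant, and constant by connectedness.\<close>

lemma hamiltonian_differ_by_constant:
  fixes A :: "('a::t2_space, 'n::finite) chart set"
  assumes A: "compact_complex_manifold A"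
    and f: "hamiltonian A \<omega> \<eta> f" and g: "hamiltonian A \<omega> \<eta> g"
  obtains k where "\<And>x. g x = f x + k"
proof -
  have at: "holomorphic_atlas A" and con: "connected (UNIV :: 'a set)"
    using A by (auto simp: compact_complex_manifold_def)
  have diff: "in_chart \<theta> c differentiable (at z)"
    if "hamiltonian A \<omega> \<eta> \<theta>" "c \<in> A" "z \<in> chart_img c" for \<theta> c z
  proof -
    have "k_smooth_on (Suc 0) (chart_img c) (in_chart \<theta> c)"
      using that unfolding hamiltonian_def smooth_function_def smooth_on_def by blast
    then show ?thesis using that by simp
  qed
  define D where "D x = g x - f x" for x
  have loc: "\<exists>U. open U \<and> x \<in> U \<and> (\<forall>y\<in>U. D y = D x)" for x
  proof -
    have "x \<in> (\<Union>c\<in>A. chart_dom c)" using at unfolding holomorphic_atlas_def by simp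
    then obtain c where c: "c \<in> A" "x \<in> chart_dom c" by blast
    note h = holomorphic_atlas_chartD[OF at c(1)]
    have p: "coord c x \<in> chart_img c" using c by (simp add: chart_img_def)
    then obtain r where r: "r > 0" and rc: "ball (coord c x) r \<subseteq> chart_img c"
      using h(2) open_contains_ball by blast
    let ?h = "\<lambda>z. in_chart g c z - in_chart f c z"
    have der: "(?h has_derivative (\<lambda>v. 0)) (at z within ball (coord c x) r)"
      if "z \<in> ball (coord c x) r" for z
    proof -
      have z: "z \<in> chart_img c" using that rc by blast
      have "(?h has_derivative (\<lambda>v. frechet_derivative (in_chart g c) (at z) v
          - frechet_derivative (in_chart f c) (at z) v)) (at z)"
        using diff[OF f c(1) z] diff[OF g c(1) z] frechet_derivative_works
        by (intro has_derivative_diff) auto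
      moreover have "frechet_derivative (in_chart g c) (at z) v
          = frechet_derivative (in_chart f c) (at z) v" for v
        using f g c(1) z unfolding hamiltonian_def by simp
      ultimately show ?thesis by (simp add: has_derivative_at_withinI)
    qed
    obtain k where k: "\<And>z. z \<in> ball (coord c x) r \<Longrightarrow> ?h z = k"
      using has_derivative_zero_constant[OF convex_ball der] by metis
    let ?U = "chart_dom c \<inter> coord c -` ball (coord c x) r"
    have "open ?U" using h(1) homeomorphism_cont1[OF h(3)]
      by (metis continuous_on_open_vimage inf_commute open_ball)
    moreover have "x \<in> ?U" using c r by simp
    moreover have "D y = k" if "y \<in> ?U" for y
      using k[of "coord c y"] that homeomorphism_apply1[OF h(3)]
      by (simp add: D_def in_chart_def)
    ultimately show ?thesis by metis
  qed
  have "D x = D y" for x y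
  proof (rule connected_local_const[OF con, of x y])
    show "\<forall>a\<in>UNIV. eventually (\<lambda>b. D a = D b) (at a within UNIV)"
      using loc unfolding eventually_at_topological by metis
  qed auto
  \<comment> \<open>\<open>undefined\<close> merely serves as an arbitrary base point of the
    manifold.\<close>
  then have "g x = f x + D undefined" for x by (metis D_def add.commute diff_add_cancel)
  then show thesis using that by blast
qed

section \<open>The formula for the Tian--Zhu invariant\<close>

theorem proposition4p15:
  fixes A :: "('a::t2_space, 'n::finite) chart set"
    and \<omega> :: "('a, 'n) form2"
    and \<phi> :: "'a \<Rightarrow> real"
    and \<xi> \<eta> :: "('a, 'n) vfield"
    and \<theta>\<^sub>\<eta> \<theta>_hat\<^sub>\<xi> \<theta>_tilde\<^sub>\<xi> \<theta>_tilde\<^sub>\<eta> :: "'a \<Rightarrow> real"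
  assumes "compact_complex_manifold A" and "fano A"
    and "kaehler_form A \<omega>"
    and "ricci_potential A \<omega> \<phi>"
    and "1 / volume A \<omega> * top_integral A ((\<lambda>x. exp (\<phi> x) - 1) \<cdot>\<^sub>F volume_form \<omega>) = 0"
    and "\<xi> \<in> aut A \<omega>" and "\<eta> \<in> aut A \<omega>"
    and "hamiltonian A \<omega> \<eta> \<theta>\<^sub>\<eta>"
    and "top_integral A (\<theta>\<^sub>\<eta> \<cdot>\<^sub>F volume_form \<omega>) = 0"
    and "hamiltonian A \<omega> \<xi> \<theta>_hat\<^sub>\<xi>"
    and "top_integral A ((\<lambda>x. exp (\<theta>_hat\<^sub>\<xi> x) - 1) \<cdot>\<^sub>F volume_form \<omega>) = 0"
    and "hamiltonian A \<omega> \<xi> \<theta>_tilde\<^sub>\<xi>"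
    and "top_integral A ((\<lambda>x. \<theta>_tilde\<^sub>\<xi> x * exp (\<phi> x)) \<cdot>\<^sub>F volume_form \<omega>) = 0"
    and "hamiltonian A \<omega> \<eta> \<theta>_tilde\<^sub>\<eta>"
    and "top_integral A ((\<lambda>x. \<theta>_tilde\<^sub>\<eta> x * exp (\<phi> x)) \<cdot>\<^sub>F volume_form \<omega>) = 0"
  shows "tian_zhu_invariant A \<omega> \<theta>_tilde\<^sub>\<eta> \<theta>_tilde\<^sub>\<xi>
    = pairing A (d_ding_hat A \<omega> \<theta>_hat\<^sub>\<xi> -\<^sub>F moment_map A \<omega> \<phi>) \<theta>\<^sub>\<eta>"
proof -
  note A = assms(1)
  \<comment> \<open>Every integral is expressed through this one functional, which is linear on
    functions continuous in charts.\<close>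
  define I where "I f = top_integral A (f \<cdot>\<^sub>F volume_form \<omega>)" for f
  let ?V = "volume A \<omega>"
  have vol: "continuous_form A (volume_form \<omega>)"
    using assms(3) two_form_volume_form_continuous unfolding kaehler_form_def by blast
  have lin: "I (\<lambda>x. a * f x + b * g x) = a * I f + b * I g"
    if "continuous_in_charts A f" "continuous_in_charts A g" for f g a b
  proof -
    have "(\<lambda>x. a * f x + b * g x) \<cdot>\<^sub>F volume_form \<omega>
        = (\<lambda>c z. a * (f \<cdot>\<^sub>F volume_form \<omega>) c z + b * (g \<cdot>\<^sub>F volume_form \<omega>) c z)"
      by (intro ext) (simp add: times_form_def algebra_simps)
    then show ?thesis
      unfolding I_def
      using top_integral_linear[OF A continuous_form_times[OF that(1) vol]
          continuous_form_times[OF that(2) vol], of a b]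
      by (simp only:)
  qed
  have scale: "I (\<lambda>x. a * f x) = a * I f" if "continuous_in_charts A f" for f a
    using lin[OF that that, of a 0] by simp
  have I1: "I (\<lambda>x. 1) = ?V"
    by (simp add: I_def volume_def times_form_def[abs_def])
  have c: "continuous_in_charts A \<phi>" "continuous_in_charts A \<theta>\<^sub>\<eta>" "continuous_in_charts A \<theta>_hat\<^sub>\<xi>"
    and ct: "continuous_in_charts A \<theta>_tilde\<^sub>\<eta>" "continuous_in_charts A \<theta>_tilde\<^sub>\<xi>"
    using assms(4,8,10,12,14) smooth_function_continuous
    unfolding ricci_potential_def hamiltonian_def by blast+
  obtain a where a: "\<And>x. \<theta>_tilde\<^sub>\<eta> x = \<theta>\<^sub>\<eta> x + a"
    using hamiltonian_differ_by_constant[OF A assms(8,14)] by blast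
  obtain b where b: "\<And>x. \<theta>_tilde\<^sub>\<xi> x = \<theta>_hat\<^sub>\<xi> x + b"
    using hamiltonian_differ_by_constant[OF A assms(10,12)] by blast
  let ?e = "\<lambda>x. exp (\<theta>_hat\<^sub>\<xi> x)" and ?f = "\<lambda>x. exp (\<phi> x)"
  note ce = continuous_in_charts_intros(1)[OF c(3)] and cf = continuous_in_charts_intros(1)[OF c(1)]
  note c\<theta>e = continuous_in_charts_intros(2)[OF c(2) ce]
    and c\<theta>f = continuous_in_charts_intros(2)[OF c(2) cf]
  have minus1: "I (\<lambda>x. u x - 1) = I u - ?V" if "continuous_in_charts A u" for u
    using lin[OF that continuous_in_charts_const, of 1 "-1" 1] by (simp add: I1)
  \<comment> \<open>The normalization of \<open>\<theta>_hat\<^sub>\<xi>\<close> says that its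
    exponential has total mass \<open>?V\<close>; this later fixes the denominator.\<close>
  have e: "I ?e = ?V"
    using assms(11) minus1[OF ce] by (simp add: I_def)
  have tilde: "I (\<lambda>x. \<theta>_tilde\<^sub>\<eta> x * u x) = I (\<lambda>x. \<theta>\<^sub>\<eta> x * u x) + a * I u"
    if "continuous_in_charts A u" for u
    using lin[OF continuous_in_charts_intros(2)[OF c(2) that] that, of 1 a]
    by (simp add: a algebra_simps)
  \<comment> \<open>The invariant is written with the n-th power of \<open>\<omega>\<close>, the
    normalizations with that power over n!. The factor n! cancels in the quotient.\<close>
  have wedge: "top_integral A (u \<cdot>\<^sub>F wedge_power \<omega>) = fact CARD('n) * I u"
    if "continuous_in_charts A u" for u
  proof -
    have "u \<cdot>\<^sub>F wedge_power \<omega> = (\<lambda>x. fact CARD('n) * u x) \<cdot>\<^sub>F volume_form \<omega>"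
      by (intro ext) (simp add: times_form_def volume_form_def)
    then show ?thesis using scale[OF that] by (simp add: I_def)
  qed
  \<comment> \<open>The shift \<open>b\<close> becomes a factor \<open>exp b\<close>, which also
    appears in \<open>den\<close>; the shift \<open>a\<close> contributes \<open>a * I ?e\<close>,
    that is \<open>a * ?V\<close>.\<close>
  have num: "I (\<lambda>x. \<theta>_tilde\<^sub>\<eta> x * exp (\<theta>_tilde\<^sub>\<xi> x)) = exp b * (I (\<lambda>x. \<theta>\<^sub>\<eta> x * ?e x) + a * ?V)"
    using scale[OF continuous_in_charts_intros(2)[OF ct(1) ce], of "exp b"] tilde[OF ce] e
    by (simp add: b exp_add mult_ac)
  have den: "I (\<lambda>x. exp (\<theta>_tilde\<^sub>\<xi> x)) = exp b * ?V"
    using scale[OF ce, of "exp b"] e by (simp add: b exp_add mult.commute)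
  have lhs: "tian_zhu_invariant A \<omega> \<theta>_tilde\<^sub>\<eta> \<theta>_tilde\<^sub>\<xi> = (I (\<lambda>x. \<theta>\<^sub>\<eta> x * ?e x) + a * ?V) / ?V"
    unfolding tian_zhu_invariant_def
    by (simp add: wedge[OF continuous_in_charts_intros(2)[OF ct(1)
          continuous_in_charts_intros(1)[OF ct(2)]]]
        wedge[OF continuous_in_charts_intros(1)[OF ct(2)]] num den)
  have rhs: "pairing A (d_ding_hat A \<omega> \<theta>_hat\<^sub>\<xi> -\<^sub>F moment_map A \<omega> \<phi>) \<theta>\<^sub>\<eta>
      = (I (\<lambda>x. \<theta>\<^sub>\<eta> x * ?e x) - I (\<lambda>x. \<theta>\<^sub>\<eta> x * ?f x)) / ?V"
  proof -
    \<comment> \<open>The constants -1 in the two densities cancel in the difference.\<close>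
    have "\<theta>\<^sub>\<eta> \<cdot>\<^sub>F (d_ding_hat A \<omega> \<theta>_hat\<^sub>\<xi> -\<^sub>F moment_map A \<omega> \<phi>)
        = (\<lambda>x. 1 / ?V * (\<theta>\<^sub>\<eta> x * ?e x) + (- 1 / ?V) * (\<theta>\<^sub>\<eta> x * ?f x)) \<cdot>\<^sub>F volume_form \<omega>"
      by (intro ext)
        (simp add: times_form_def diff_form_def d_ding_hat_def moment_map_def diff_divide_distrib algebra_simps)
    then show ?thesis
      using lin[OF c\<theta>e c\<theta>f, of "1 / ?V" "- 1 / ?V"]
      by (simp add: pairing_def I_def diff_divide_distrib)
  qed
  show ?thesis
  proof (cases "?V = 0")
    case True
    \<comment> \<open>Excluded by positivity of \<open>\<omega>\<^sup>n\<close>, which need not be proved: here both sides are \<open>x / 0 = 0\<close>.\<close>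
    then show ?thesis by (simp add: lhs rhs)
  next
    case False
    \<comment> \<open>The normalization of \<open>\<phi>\<close> carries the prefactor
      \<open>1 / ?V\<close>, which can be removed only when \<open>?V\<close> is nonzero.\<close>
    then have "I ?f = ?V"
      using assms(5) minus1[OF cf] by (simp add: I_def)
    \<comment> \<open>The weighted normalization of \<open>\<theta>_tilde\<^sub>\<eta>\<close>
      determines \<open>a\<close>, and makes the numerators of \<open>lhs\<close> and
      \<open>rhs\<close> agree.\<close>
    then have "a * ?V = - I (\<lambda>x. \<theta>\<^sub>\<eta> x * ?f x)"
      using assms(15) tilde[OF cf] by (simp add: I_def)
    then show ?thesis by (simp add: lhs rhs)
  qed
qed

end
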